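(* Let $a,b\ge2$ and $c,d\ge0$ be integers and let $\pi=123[\iota_c,21[\iota_a,\iota_b],\iota_d]$, i.e. $\pi=1\,2\cdots c\,(c+b+1)(c+b+2)\cdots(c+b+a)\,(c+1)(c+2)\cdots(c+b)\,(c+a+b+1)\cdots(c+a+b+d)\in\mathfrak S_{a+b+c+d}$. Then $\operatorname{diam}(G_{\pi})=\frac12|L_2(\pi)|$.
   Context: $\iota_k=12\cdots k$ denotes the identity of $\mathfrak S_k$ ($\iota_0$ empty). For $\alpha\in\mathfrak S_a,\beta\in\mathfrak S_b$, $21[\alpha,\beta]=(\alpha_1+b)\cdots(\alpha_a+b)\beta_1\cdots\beta_b$. For $\pi\in\mathfrak S_n$, an inversion is a pair $(i,j)$ with $i<j$, $\pi_i>\pi_j$; $I_2(\pi)$ is the set of unordered pairs of disjoint inversions, $I_3(\pi)$ the set of triples of inversions $((i,j),(i,k),(j,k))$ with $i<j<k$ (occurrences of $321$), and $|L_2(\pi)|=|I_2(\pi)|+|I_3(\pi)|$. $R(\pi)$ is the set of reduced words of $\pi$ (minimal-length words $r_1\cdots r_\ell$ in $[n-1]$ with $\pi=s_{r_1}\cdots s_{r_\ell}$, $s_i=(i,i+1)$); $G_\pi$ is the graph on $R(\pi)$ whose edges join words related by one commutation move (exchange adjacent $jk$, $|j-k|>1$) or one long braid move (consecutive $j(j+1)j\leftrightarrow(j+1)j(j+1)$). Diameter = maximum distance between two vertices. *)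

theory Defs
  imports
    "HOL-Combinatorics.Permutations"
    "Graph_Theory.Graph_Theory"
begin

section \<open>Permutations in one-line notation\<close>

definition iota :: "nat \<Rightarrow> nat list" where
  "iota k = [1..<Suc k]"

text \<open>The inflations \<open>21[\<alpha>, \<beta>]\<close> and \<open>123[\<alpha>, \<beta>, \<gamma>]\<close>.\<close>

definition inflate21 :: "nat list \<Rightarrow> nat list \<Rightarrow> nat list" where
  "inflate21 \<alpha> \<beta> = map (\<lambda>x. x + length \<beta>) \<alpha> @ \<beta>"

definition inflate123 :: "nat list \<Rightarrow> nat list \<Rightarrow> nat list \<Rightarrow> nat list" where
  "inflate123 \<alpha> \<beta> \<gamma> =
     \<alpha> @ map (\<lambda>x. x + length \<alpha>) \<beta> @ map (\<lambda>x. x + (length \<alpha> + length \<beta>)) \<gamma>"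

text \<open>
  An element of \<open>S\<^sub>n\<close> is a function \<open>\<pi>\<close> with \<open>\<pi> permutes {1..n}\<close>; one-line words are indexed
  from 1, and the function is the identity outside \<open>{1..n}\<close>.
\<close>

definition perm_of_word :: "nat list \<Rightarrow> nat \<Rightarrow> nat" where
  "perm_of_word w i = (if i \<in> {1..length w} then w ! (i - 1) else i)"

section \<open>Inversions\<close>

definition inversions :: "nat \<Rightarrow> (nat \<Rightarrow> nat) \<Rightarrow> (nat \<times> nat) set" where
  "inversions n \<pi> = {(i, j). i \<in> {1..n} \<and> j \<in> {1..n} \<and> i < j \<and> \<pi> i > \<pi> j}"

definition I2 :: "nat \<Rightarrow> (nat \<Rightarrow> nat) \<Rightarrow> (nat \<times> nat) set set" where
  "I2 n \<pi> = {{(i, j), (k, l)} | i j k l.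
     (i, j) \<in> inversions n \<pi> \<and> (k, l) \<in> inversions n \<pi> \<and> {i, j} \<inter> {k, l} = {}}"

definition I3 :: "nat \<Rightarrow> (nat \<Rightarrow> nat) \<Rightarrow> ((nat \<times> nat) \<times> (nat \<times> nat) \<times> (nat \<times> nat)) set" where
  "I3 n \<pi> = {((i, j), (i, k), (j, k)) | i j k. i < j \<and> j < k \<and>
     (i, j) \<in> inversions n \<pi> \<and> (i, k) \<in> inversions n \<pi> \<and> (j, k) \<in> inversions n \<pi>}"

definition card_L2 :: "nat \<Rightarrow> (nat \<Rightarrow> nat) \<Rightarrow> nat" where
  "card_L2 n \<pi> = card (I2 n \<pi>) + card (I3 n \<pi>)"

section \<open>Reduced words and their graph\<close>

definition word_prod :: "nat list \<Rightarrow> nat \<Rightarrow> nat" where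
  "word_prod w = foldr (\<lambda>i f. transpose i (i + 1) \<circ> f) w id"

definition words_for :: "nat \<Rightarrow> (nat \<Rightarrow> nat) \<Rightarrow> nat list set" where
  "words_for n \<pi> = {w. set w \<subseteq> {1..n - 1} \<and> word_prod w = \<pi>}"

definition reduced_words :: "nat \<Rightarrow> (nat \<Rightarrow> nat) \<Rightarrow> nat list set" where
  "reduced_words n \<pi> =
     {w \<in> words_for n \<pi>. \<forall>v \<in> words_for n \<pi>. length w \<le> length v}"

definition commutation_move :: "nat list \<Rightarrow> nat list \<Rightarrow> bool" where
  "commutation_move u v \<longleftrightarrow> (\<exists>x y j k. \<bar>int j - int k\<bar> > 1 \<and>
     u = x @ [j, k] @ y \<and> v = x @ [k, j] @ y)"

definition braid_move :: "nat list \<Rightarrow> nat list \<Rightarrow> bool" where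
  "braid_move u v \<longleftrightarrow> (\<exists>x y j.
     u = x @ [j, j + 1, j] @ y \<and> v = x @ [j + 1, j, j + 1] @ y \<or>
     u = x @ [j + 1, j, j + 1] @ y \<and> v = x @ [j, j + 1, j] @ y)"

text \<open>The undirected graph is encoded as a digraph with a symmetric arc set.\<close>

definition word_graph :: "nat \<Rightarrow> (nat \<Rightarrow> nat) \<Rightarrow> nat list pair_pre_digraph" where
  "word_graph n \<pi> = \<lparr> pverts = reduced_words n \<pi>,
     parcs = {(u, v). u \<in> reduced_words n \<pi> \<and> v \<in> reduced_words n \<pi> \<and>
       (commutation_move u v \<or> braid_move u v)} \<rparr>"

text \<open>
  With unit weights \<open>wf_digraph.\<mu>\<close> is the graph distance: the least length of a walk, and
  \<open>\<infinity>\<close> if there is none.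
\<close>

definition graph_dist :: "'a pair_pre_digraph \<Rightarrow> 'a \<Rightarrow> 'a \<Rightarrow> ereal" where
  "graph_dist H u v = wf_digraph.\<mu> (with_proj H) (\<lambda>_. 1) u v"

definition diam :: "'a pair_pre_digraph \<Rightarrow> ereal" where
  "diam H = (SUP u \<in> pverts H. SUP v \<in> pverts H. graph_dist H u v)"

section \<open>Basic facts\<close>

lemma length_iota [simp]: "length (iota k) = k"
  by (simp add: iota_def)

lemma nth_iota: "m < k \<Longrightarrow> iota k ! m = m + 1"
  by (simp add: iota_def del: upt_Suc)

lemma perm_of_word_inflation:
  fixes a b c d i :: nat
  shows "perm_of_word (inflate123 (iota c) (inflate21 (iota a) (iota b)) (iota d)) i =
    (if i \<in> {c + 1..c + a} then i + b
     else if i \<in> {c + a + 1..c + a + b} then i - a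
     else i)"
proof -
  consider "i = 0" | m where "m < c" "i = Suc m" | m where "m < a" "i = Suc (c + m)"
    | m where "m < b" "i = Suc (c + a + m)" | m where "m < d" "i = Suc (c + a + b + m)"
    | "c + a + b + d < i"
  proof -
    consider "i = 0" | "1 \<le> i" "i \<le> c" | "c + 1 \<le> i" "i \<le> c + a"
      | "c + a + 1 \<le> i" "i \<le> c + a + b" | "c + a + b + 1 \<le> i" "i \<le> c + a + b + d"
      | "c + a + b + d < i"
      by linarith
    then show ?thesis
    proof cases
      case 1 then show ?thesis by (rule that(1))
    next
      case 2 then show ?thesis by (intro that(2)[of "i - 1"]) simp_all
    next
      case 3 then show ?thesis by (intro that(3)[of "i - (c + 1)"]) simp_all
    next
      case 4 then show ?thesis by (intro that(4)[of "i - (c + a + 1)"]) simp_all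
    next
      case 5 then show ?thesis by (intro that(5)[of "i - (c + a + b + 1)"]) simp_all
    next
      case 6 then show ?thesis by (rule that(6))
    qed
  qed
  then show ?thesis
    by cases (simp_all add: perm_of_word_def inflate123_def inflate21_def nth_append nth_iota)
qed

lemma perm_of_word_inflation_permutes:
  fixes a b c d :: nat
  shows "perm_of_word (inflate123 (iota c) (inflate21 (iota a) (iota b)) (iota d))
    permutes {1..a + b + c + d}"
    (is "?\<pi> permutes ?S")
proof (rule bij_imp_permutes)
  have "inj_on ?\<pi> ?S"
  proof (rule inj_onI)
    fix x y assume "?\<pi> x = ?\<pi> y"
    then show "x = y"
      unfolding perm_of_word_inflation atLeastAtMost_iff by (auto split: if_splits)
  qed
  moreover have "?\<pi> ` ?S \<subseteq> ?S"
  proof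
    fix y assume "y \<in> ?\<pi> ` ?S"
    then obtain x where "x \<in> ?S" "y = ?\<pi> x" by blast
    then show "y \<in> ?S"
      unfolding perm_of_word_inflation atLeastAtMost_iff by (auto split: if_splits)
  qed
  ultimately show "bij_betw ?\<pi> ?S ?S"
    by (simp add: bij_betw_def endo_inj_surj)
  show "?\<pi> i = i" if "i \<notin> ?S" for i
    using that unfolding perm_of_word_inflation atLeastAtMost_iff by (auto split: if_splits)
qed

lemma commutation_move_sym:
  assumes "commutation_move u v"
  shows "commutation_move v u"
proof -
  obtain x y j k where "\<bar>int j - int k\<bar> > 1" "u = x @ [j, k] @ y" "v = x @ [k, j] @ y"
    using assms unfolding commutation_move_def by blast
  then have "\<bar>int k - int j\<bar> > 1 \<and> v = x @ [k, j] @ y \<and> u = x @ [j, k] @ y"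
    by linarith
  then show ?thesis
    unfolding commutation_move_def by blast
qed

lemma braid_move_sym:
  assumes "braid_move u v"
  shows "braid_move v u"
  using assms unfolding braid_move_def by blast

lemma finite_reduced_words: "finite (reduced_words n \<pi>)"
proof (cases "reduced_words n \<pi> = {}")
  case False
  then obtain w where w: "w \<in> reduced_words n \<pi>" by blast
  have "reduced_words n \<pi> \<subseteq> {v. set v \<subseteq> {1..n - 1} \<and> length v \<le> length w}"
    using w by (auto simp: reduced_words_def words_for_def)
  then show ?thesis
    by (rule finite_subset) (simp add: finite_lists_length_le)
qed simp

lemma pair_graph_word_graph: "pair_graph (word_graph n \<pi>)"
proof
  show "finite (pverts (word_graph n \<pi>))"
    by (simp add: word_graph_def finite_reduced_words)
  have "parcs (word_graph n \<pi>) \<subseteq> pverts (word_graph n \<pi>) \<times> pverts (word_graph n \<pi>)"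
    by (auto simp: word_graph_def)
  then show "finite (parcs (word_graph n \<pi>))"
    by (rule finite_subset) (simp add: word_graph_def finite_reduced_words)
  show "symmetric (with_proj (word_graph n \<pi>))"
    by (auto simp: symmetric_def arcs_ends_def arc_to_ends_def word_graph_def sym_def
             dest: commutation_move_sym braid_move_sym)
qed (fastforce simp: word_graph_def commutation_move_def braid_move_def)+

lemma graph_dist_word_graph:
  "graph_dist (word_graph n \<pi>) u v =
     (INF p \<in> {p. pre_digraph.awalk (with_proj (word_graph n \<pi>)) u p v}. ereal (length p))"
proof -
  interpret pair_graph "word_graph n \<pi>" by (rule pair_graph_word_graph)
  show ?thesis
    by (simp add: graph_dist_def \<mu>_def awalk_cost_def sum_list_triv)
qed

end

theory Submission
  imports Defs
begin

text \<open>
  Every inversion of \<open>\<pi>\<close> pairs an entry of the left block with one of the right block, so the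
  inversions form an \<open>a \<times> b\<close> rectangle of cells. Multiplying out a reduced word from the right
  creates the inversions one at a time, and an inversion can be created exactly when its cell can
  be added to the partition formed by the earlier ones. Hence reduced words are the linear
  extensions of the product order on the rectangle, a commutation move exchanges two adjacent
  incomparable cells, and long braid moves do not occur. The distance of two linear extensions is
  the number of incomparable pairs which they order differently; filling the rectangle by rows and
  by columns reverses all of them. Each incomparable pair of cells accounts for two pairs of
  disjoint inversions, one for each way to match the two rows with the two columns.
\<close>

section \<open>The order of the entries of a list\<close>

fun order_pairs :: "'a list \<Rightarrow> ('a \<times> 'a) set" where
  "order_pairs [] = {}"
| "order_pairs (x # xs) = {x} \<times> set xs \<union> order_pairs xs"

lemma order_pairs_append:
  "order_pairs (xs @ ys) = order_pairs xs \<union> order_pairs ys \<union> set xs \<times> set ys"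
  by (induction xs) auto

lemma order_pairs_memD: "(x, y) \<in> order_pairs xs \<Longrightarrow> x \<in> set xs \<and> y \<in> set xs"
  by (induction xs) auto

lemma finite_order_pairs: "finite (order_pairs xs)"
  by (induction xs) auto

lemma order_pairs_total:
  assumes "x \<in> set xs" "y \<in> set xs" "x \<noteq> y"
  shows "(x, y) \<in> order_pairs xs \<or> (y, x) \<in> order_pairs xs"
  using assms by (induction xs) auto

lemma order_pairs_asym:
  assumes "distinct xs" "(x, y) \<in> order_pairs xs"
  shows "(y, x) \<notin> order_pairs xs"
  using assms by (induction xs) (auto dest: order_pairs_memD)

lemma order_pairs_trans:
  assumes "distinct xs" "(x, y) \<in> order_pairs xs" "(y, z) \<in> order_pairs xs"
  shows "(x, z) \<in> order_pairs xs"
  using assms by (induction xs) (auto dest: order_pairs_memD)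

lemma order_pairs_swap:
  assumes "distinct (xs @ [x, y] @ ys)"
  shows "order_pairs (xs @ [y, x] @ ys) =
    insert (y, x) (order_pairs (xs @ [x, y] @ ys) - {(x, y)})"
  using assms by (auto simp: order_pairs_append dest: order_pairs_memD)

text \<open>If the heads \<open>x\<close> and \<open>y\<close> differed, then \<open>x\<close> would
  precede \<open>y\<close> in \<open>xs\<close> but follow it in \<open>ys\<close>. This turns "no
  pair is reversed" into equality, the end of the sorting process.\<close>

lemma order_pairs_subset_imp_eq:
  assumes "distinct xs" "distinct ys" "set xs = set ys" "order_pairs xs \<subseteq> order_pairs ys"
  shows "xs = ys"
  using assms
proof (induction xs arbitrary: ys)
  case (Cons x xs)
  obtain y zs where ys: "ys = y # zs"
    using Cons.prems(3) by (cases ys) auto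
  have "x = y"
  proof (rule ccontr)
    assume "x \<noteq> y"
    then have "y \<in> set xs" "x \<in> set zs"
      using Cons.prems(3) unfolding ys by auto
    then have "(x, y) \<in> order_pairs ys" "(y, x) \<in> order_pairs ys"
      using Cons.prems(4) by (auto simp: ys)
    then show False
      using order_pairs_asym Cons.prems(2) by fast
  qed
  have notin: "x \<notin> set xs" "x \<notin> set zs" "distinct xs" "distinct zs"
    using Cons.prems(1,2) by (simp_all add: ys \<open>x = y\<close>)
  have "set xs = set zs"
    using Cons.prems(3) notin by (simp add: ys \<open>x = y\<close> insert_ident)
  moreover have "order_pairs xs \<subseteq> order_pairs zs"
  proof
    fix p assume p: "p \<in> order_pairs xs"
    then have "p \<in> order_pairs ys" "fst p \<noteq> x"
      using Cons.prems(4) notin(1) by (cases p; auto dest: order_pairs_memD)+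
    then show "p \<in> order_pairs zs"
      by (auto simp: ys \<open>x = y\<close>)
  qed
  ultimately have "xs = zs"
    using notin by (intro Cons.IH)
  then show ?case
    by (simp add: ys \<open>x = y\<close>)
qed simp

text \<open>A transitive relation that holds between all neighbours of a list holds between all its
  ordered pairs. With \<open>R\<close> the order of a target list, this finds the next exchange of a
  bubble sort.\<close>

lemma ex_adjacent_not_related:
  assumes "\<not> order_pairs xs \<subseteq> R" "trans R"
  shows "\<exists>us x y vs. xs = us @ [x, y] @ vs \<and> (x, y) \<notin> R"
  using assms(1)
proof (induction xs)
  case (Cons x xs)
  show ?case
  proof (cases "order_pairs xs \<subseteq> R")
    case True
    then obtain z where z: "z \<in> set xs" "(x, z) \<notin> R"
      using Cons.prems by auto
    then obtain y ys where ys: "xs = y # ys"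
      by (cases xs) auto
    have "(x, y) \<notin> R"
    proof
      assume "(x, y) \<in> R"
      then have "(y, z) \<notin> R" "y \<noteq> z"
        using z(2) transD[OF \<open>trans R\<close>] by blast+
      then show False
        using z(1) ys True by auto
    qed
    moreover have "x # xs = [] @ [x, y] @ ys"
      using ys by simp
    ultimately show ?thesis
      by blast
  next
    case False
    then obtain us p q vs where "xs = us @ [p, q] @ vs" and R: "(p, q) \<notin> R"
      using Cons.IH by blast
    then have "x # xs = (x # us) @ [p, q] @ vs"
      by simp
    then show ?thesis
      using R by blast
  qed
qed auto

section \<open>Rectangular tableaux as lists of cells\<close>

definition row_len :: "nat \<Rightarrow> (nat \<times> nat) list \<Rightarrow> nat" where
  "row_len i xs = length (filter (\<lambda>p. fst p = i) xs)"

definition col_len :: "nat \<Rightarrow> (nat \<times> nat) list \<Rightarrow> nat" where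
  "col_len j xs = length (filter (\<lambda>p. snd p = j) xs)"

lemma row_len_simps [simp]:
  "row_len i [] = 0"
  "row_len i (p # xs) = (if fst p = i then Suc (row_len i xs) else row_len i xs)"
  "row_len i (xs @ ys) = row_len i xs + row_len i ys"
  by (auto simp: row_len_def)

lemma col_len_simps [simp]:
  "col_len i [] = 0"
  "col_len i (p # xs) = (if snd p = i then Suc (col_len i xs) else col_len i xs)"
  "col_len i (xs @ ys) = col_len i xs + col_len i ys"
  by (auto simp: col_len_def)

text \<open>
  A list of cells is read from right to left as the growth of a partition inside the
  \<open>a \<times> b\<close> rectangle: a new cell \<open>(i, j)\<close> can be added exactly if row \<open>i\<close> has length \<open>j\<close>
  and column \<open>j\<close> has length \<open>i\<close>.
\<close>

fun tableau :: "nat \<Rightarrow> nat \<Rightarrow> (nat \<times> nat) list \<Rightarrow> bool" where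
  "tableau a b [] \<longleftrightarrow> True"
| "tableau a b (p # xs) \<longleftrightarrow> tableau a b xs \<and> fst p < a \<and> snd p < b \<and>
     row_len (fst p) xs = snd p \<and> col_len (snd p) xs = fst p"

lemma tableau_appendD: "tableau a b (xs @ ys) \<Longrightarrow> tableau a b ys"
  by (induction xs) auto

text \<open>Adding cells to a partition depends only on its row and column lengths, not on the order
  in which it was filled.\<close>

lemma tableau_append_cong:
  assumes "tableau a b (xs @ ys)" "tableau a b zs"
    "\<And>i. row_len i ys = row_len i zs" "\<And>j. col_len j ys = col_len j zs"
  shows "tableau a b (xs @ zs)"
  using assms by (induction xs) auto

lemma tableau_mem_row_len:
  assumes "tableau a b xs"
  shows "(i, j) \<in> set xs \<longleftrightarrow> i < a \<and> j < row_len i xs"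
  using assms by (induction xs) (auto split: if_splits)

lemma tableau_mem_col_len:
  assumes "tableau a b xs"
  shows "(i, j) \<in> set xs \<longleftrightarrow> j < b \<and> i < col_len j xs"
  using assms by (induction xs) (auto split: if_splits)

lemma tableau_subset: "tableau a b xs \<Longrightarrow> set xs \<subseteq> {..<a} \<times> {..<b}"
  by (induction xs) auto

lemma tableau_distinct: "tableau a b xs \<Longrightarrow> distinct xs"
proof (induction xs)
  case (Cons p xs)
  then show ?case
    using tableau_mem_row_len[of a b xs "fst p" "snd p"] by auto
qed simp

lemma tableau_full:
  assumes "tableau a b xs" "length xs = a * b"
  shows "set xs = {..<a} \<times> {..<b}"
  using assms tableau_subset[OF assms(1)] distinct_card[OF tableau_distinct[OF assms(1)]]
  by (intro card_subset_eq) auto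

text \<open>If a new cell \<open>(i, j)\<close> were weakly below \<open>(i', j')\<close> in both
  coordinates, column \<open>j'\<close> would already contain \<open>(i, j')\<close>, so row
  \<open>i\<close> would be longer than \<open>j\<close>. Hence the list, read from the right, is a
  linear extension of the product order.\<close>

lemma tableau_order_pairs:
  assumes "tableau a b xs" "((i, j), (i', j')) \<in> order_pairs xs"
  shows "i' < i \<or> j' < j"
  using assms
proof (induction xs)
  case (Cons p xs)
  show ?case
  proof (cases "((i, j), (i', j')) \<in> order_pairs xs")
    case False
    then have p: "p = (i, j)" "(i', j') \<in> set xs"
      using Cons.prems by auto
    show ?thesis
    proof (rule ccontr)
      assume "\<not> (i' < i \<or> j' < j)"
      then have "(i, j') \<in> set xs"
        using p Cons.prems tableau_mem_col_len[of a b xs] by auto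
      then have "j' < j"
        using p Cons.prems tableau_mem_row_len[of a b xs] by auto
      then show False
        using \<open>\<not> (i' < i \<or> j' < j)\<close> by simp
    qed
  qed (use Cons in auto)
qed simp

text \<open>The usual content \<open>j - i\<close> of a cell, shifted by \<open>s\<close>. It is
  applied to cells with \<open>i < a \<le> s\<close>, so the subtraction does not truncate.\<close>

fun content :: "nat \<Rightarrow> nat \<times> nat \<Rightarrow> nat" where
  "content s (i, j) = s - i + j"

text \<open>Equal content means the same diagonal, and a partition has at most one addable cell on
  each diagonal: a second one further along would force the first to be filled already.\<close>

lemma tableau_content_inj:
  assumes "tableau a b (p # xs)" "tableau a b (q # xs)" "content s p = content s q" "a \<le> s"
  shows "p = q"
proof -
  have less: False if "tableau a b ((i, j) # xs)" "tableau a b ((i', j') # xs)"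
    "i < i'" "j < j'" for i j i' j'
  proof -
    have "(i, j') \<in> set xs"
      using that tableau_mem_col_len[of a b xs] by auto
    then show False
      using that tableau_mem_row_len[of a b xs] by auto
  qed
  obtain i j i' j' where pq: "p = (i, j)" "q = (i', j')"
    by fastforce
  have "s - i + j = s - i' + j'" "i < a" "i' < a"
    using assms pq by simp_all
  then consider "i < i'" "j < j'" | "i' < i" "j' < j" | "i = i'" "j = j'"
    using \<open>a \<le> s\<close> by linarith
  then show ?thesis
    by cases (use less[of i j i' j'] less[of i' j' i j] assms(1,2) pq in blast)+
qed

lemma tableau_map_content_inj:
  assumes "tableau a b xs" "tableau a b ys" "map (content s) xs = map (content s) ys" "a \<le> s"
  shows "xs = ys"
  using assms
proof (induction xs arbitrary: ys)
  case (Cons p xs)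
  then obtain q zs where ys: "ys = q # zs" "content s p = content s q"
    "map (content s) xs = map (content s) zs"
    by (cases ys) auto
  then have "xs = zs"
    using Cons by auto
  then show ?case
    using ys Cons.prems tableau_content_inj[of a b p xs q s] by blast
qed simp

text \<open>Cells added consecutively in one row or column are neighbours, with contents differing
  by one. Cells of distant content therefore share neither, and neither affects whether the other
  can be added.\<close>

lemma tableau_swap:
  assumes "tableau a b (xs @ [p, q] @ ys)" "\<bar>int (content s p) - int (content s q)\<bar> > 1" "a \<le> s"
  shows "tableau a b (xs @ [q, p] @ ys)"
proof -
  have tail: "tableau a b ([p, q] @ ys)"
    using assms(1) by (rule tableau_appendD)
  have "fst p \<noteq> fst q" "snd p \<noteq> snd q"
    using tail assms(2,3) by (cases p; cases q; auto)+
  then have "tableau a b ([q, p] @ ys)"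
    using tail by auto
  then show ?thesis
    by (rule tableau_append_cong[OF assms(1)]) simp_all
qed

text \<open>
  Between two cells of equal content at least two further cells are added: the neighbours of the
  earlier one in its row and in its column.
\<close>

lemma tableau_no_braid:
  assumes "tableau a b (xs @ [p, q, r] @ ys)" "a \<le> s"
  shows "content s p \<noteq> content s r"
proof
  assume eq: "content s p = content s r"
  have tab: "tableau a b (p # q # r # ys)"
    using tableau_appendD[OF assms(1)] unfolding append.simps .
  obtain i j i' j' where pr: "p = (i, j)" "r = (i', j')"
    by fastforce
  have "i' < i \<or> j' < j"
    using tableau_order_pairs[OF tab] pr by auto
  then have less: "i' < i" "j' < j"
    using eq tab pr assms(2) by auto
  define qs where "qs = q # r # ys"
  define rs where "rs = r # ys"
  have tabs: "tableau a b qs" "tableau a b rs" "set qs = insert q (set rs)"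
    and p: "row_len i qs = j" "col_len j qs = i" "i < a" "j < b"
    and r: "row_len i' rs = Suc j'" "col_len j' rs = Suc i'"
    using tab pr by (simp_all add: qs_def rs_def)
  note row = tableau_mem_row_len[OF tabs(1)] tableau_mem_row_len[OF tabs(2)]
  note col = tableau_mem_col_len[OF tabs(1)] tableau_mem_col_len[OF tabs(2)]
  have "(i, j') \<in> set qs" "(i', j) \<in> set qs"
    using p less row(1)[of i j'] col(1)[of i' j] by simp_all
  then have "(Suc i', j') \<in> set qs" "(i', Suc j') \<in> set qs"
    using less row(1)[of i' j] row(1)[of i' "Suc j'"] col(1)[of i j'] col(1)[of "Suc i'" j']
    by simp_all
  moreover have "(Suc i', j') \<notin> set rs" "(i', Suc j') \<notin> set rs"
    using r row(2)[of i' "Suc j'"] col(2)[of "Suc i'" j'] by simp_all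
  ultimately show False
    using tabs(3) by auto
qed

section \<open>Complete fillings of the rectangle, by rows and by columns\<close>

definition tableaux :: "nat \<Rightarrow> nat \<Rightarrow> (nat \<times> nat) list set" where
  "tableaux a b = {xs. tableau a b xs \<and> length xs = a * b}"

text \<open>Read from the right, this fills row 0 from left to right, then row 1, and so on; hence
  the reversal. It and a transposed copy will be two vertices at maximal distance.\<close>

fun stacked_rows :: "nat \<Rightarrow> nat \<Rightarrow> (nat \<times> nat) list" where
  "stacked_rows b 0 = []"
| "stacked_rows b (Suc m) = map (Pair m) (rev [0..<b]) @ stacked_rows b m"

lemma length_stacked_rows: "length (stacked_rows b m) = m * b"
  by (induction m) auto

lemma row_len_map_Pair: "row_len i (map (Pair m) js) = (if i = m then length js else 0)"
  by (induction js) auto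

lemma col_len_map_Pair:
  "distinct js \<Longrightarrow> col_len j (map (Pair m) js) = (if j \<in> set js then 1 else 0)"
  by (induction js) auto

lemma row_len_stacked_rows: "row_len i (stacked_rows b m) = (if i < m then b else 0)"
  by (induction m) (auto simp: row_len_map_Pair)

lemma col_len_stacked_rows: "col_len j (stacked_rows b m) = (if j < b then m else 0)"
  by (induction m) (auto simp: col_len_map_Pair)

lemma tableau_stacked_rows: "m \<le> a \<Longrightarrow> tableau a b (stacked_rows b m)"
proof (induction m)
  case (Suc m)
  \<comment> \<open>Row \<open>m\<close> filled only up to column \<open>k\<close>, so that an inner
    induction can add one cell at a time.\<close>
  have "tableau a b (map (Pair m) (rev [0..<k]) @ stacked_rows b m)" if "k \<le> b" for k
    using that Suc
    by (induction k) (simp_all add: row_len_map_Pair col_len_map_Pair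
      row_len_stacked_rows col_len_stacked_rows)
  then show ?case
    by simp
qed simp

lemma stacked_rows_in_tableaux: "stacked_rows b a \<in> tableaux a b"
  by (simp add: tableaux_def tableau_stacked_rows length_stacked_rows)

lemma row_len_map_swap: "row_len i (map prod.swap xs) = col_len i xs"
  by (induction xs) auto

lemma col_len_map_swap: "col_len i (map prod.swap xs) = row_len i xs"
  by (induction xs) auto

lemma tableau_map_swap: "tableau a b xs \<Longrightarrow> tableau b a (map prod.swap xs)"
  by (induction xs) (auto simp: row_len_map_swap col_len_map_swap)

lemma tableaux_map_swap: "xs \<in> tableaux a b \<Longrightarrow> map prod.swap xs \<in> tableaux b a"
  by (simp add: tableaux_def tableau_map_swap)

lemma order_pairs_map: "order_pairs (map f xs) = map_prod f f ` order_pairs xs"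
  by (induction xs) auto

lemma order_pairs_stacked_rows:
  "((i, j), (i', j')) \<in> order_pairs (stacked_rows b m) \<Longrightarrow> i' \<le> i"
proof (induction m)
  case (Suc m)
  have "fst p < m" if "p \<in> set (stacked_rows b m)" for p
    using that by (induction m) auto
  then show ?case
    using Suc by (force simp: order_pairs_append order_pairs_map)
qed simp

section \<open>Incomparable cells\<close>

text \<open>Each unordered pair incomparable in the product order occurs once, with the cell of
  smaller row index first.\<close>

definition incomparable :: "nat \<Rightarrow> nat \<Rightarrow> ((nat \<times> nat) \<times> (nat \<times> nat)) set" where
  "incomparable a b = {((i, j), (i', j')). i < i' \<and> i' < a \<and> j' < j \<and> j < b}"

lemma finite_incomparable: "finite (incomparable a b)"
proof -
  have "incomparable a b \<subseteq> ({..<a} \<times> {..<b}) \<times> ({..<a} \<times> {..<b})"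
    by (auto simp: incomparable_def)
  then show ?thesis
    by (rule finite_subset) auto
qed

lemma card_reversed_pairs_le:
  assumes "xs \<in> tableaux a b" "ys \<in> tableaux a b"
  shows "card (order_pairs xs - order_pairs ys) \<le> card (incomparable a b)"
proof -
  have tab: "tableau a b xs" "tableau a b ys"
    and sets: "set xs = {..<a} \<times> {..<b}" "set ys = {..<a} \<times> {..<b}"
    using assms tableau_full by (auto simp: tableaux_def)
  let ?f = "\<lambda>(p, q). if fst p < fst q then (p, q) else (q, p)"
  have rev: "(q, p) \<in> order_pairs ys" if "(p, q) \<in> order_pairs xs - order_pairs ys" for p q
  proof -
    have "p \<in> set ys" "q \<in> set ys" "p \<noteq> q"
      using that order_pairs_memD[of p q xs] order_pairs_asym[of xs p q]
        tableau_distinct[OF tab(1)] sets by auto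
    then show ?thesis
      using that order_pairs_total[of p ys q] by blast
  qed
  \<comment> \<open>By \<open>rev\<close>, the two orientations of a pair cannot both be in the
    difference.\<close>
  have "inj_on ?f (order_pairs xs - order_pairs ys)"
    using rev by (intro inj_onI) (auto split: if_splits)
  moreover have "?f ` (order_pairs xs - order_pairs ys) \<subseteq> incomparable a b"
  proof
    fix r assume "r \<in> ?f ` (order_pairs xs - order_pairs ys)"
    then obtain i j i' j' where r: "((i, j), (i', j')) \<in> order_pairs xs - order_pairs ys"
      "r = ?f ((i, j), (i', j'))"
      by auto
    \<comment> \<open>Both tableaux extend the product order, so a pair on which they disagree is
      incomparable.\<close>
    have "i' < i \<or> j' < j" "i < i' \<or> j < j'"
      using tableau_order_pairs[OF tab(1)] tableau_order_pairs[OF tab(2)] rev r(1) by blast+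
    moreover have "i < a" "i' < a" "j < b" "j' < b"
      using order_pairs_memD[of _ _ xs] r(1) sets by auto
    ultimately show "r \<in> incomparable a b"
      using r(2) by (auto simp: incomparable_def)
  qed
  ultimately show ?thesis
    using finite_incomparable by (intro card_inj_on_le)
qed

lemma incomparable_stacked_rows: "incomparable a b \<inter> order_pairs (stacked_rows b a) = {}"
  using order_pairs_stacked_rows by (fastforce simp: incomparable_def)

text \<open>Transposition makes the list run through the columns from last to first, and the first
  cell of a pair in \<open>incomparable\<close> has the larger column index.\<close>

lemma incomparable_stacked_columns:
  "incomparable a b \<subseteq> order_pairs (map prod.swap (stacked_rows a b))"
proof
  fix r assume "r \<in> incomparable a b"
  then obtain i j i' j' where r: "r = ((i, j), (i', j'))" "i < i'" "i' < a" "j' < j" "j < b"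
    by (auto simp: incomparable_def)
  have "set (stacked_rows a b) = {..<b} \<times> {..<a}"
    using stacked_rows_in_tableaux[of a b] tableau_full by (auto simp: tableaux_def)
  then have "((j, i), (j', i')) \<in> order_pairs (stacked_rows a b)"
    using r order_pairs_total[of "(j, i)" "stacked_rows a b" "(j', i')"]
      order_pairs_stacked_rows[of j' i' j i a b] by auto
  then have "map_prod prod.swap prod.swap ((j, i), (j', i'))
      \<in> order_pairs (map prod.swap (stacked_rows a b))"
    unfolding order_pairs_map by (rule imageI)
  then show "r \<in> order_pairs (map prod.swap (stacked_rows a b))"
    by (simp add: r(1))
qed

section \<open>Inversions along a word\<close>

lemma word_prod_simps [simp]:
  "word_prod [] = id"
  "word_prod (r # w) = transpose r (Suc r) \<circ> word_prod w"
  by (simp_all add: word_prod_def)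

lemma word_prod_append: "word_prod (u @ v) = word_prod u \<circ> word_prod v"
  by (induction u) (simp_all add: comp_assoc)

lemma inj_word_prod: "inj (word_prod w)"
proof (induction w)
  case (Cons r w)
  then show ?case
    unfolding word_prod_simps by (intro inj_compose inj_on_transpose)
qed simp

lemma finite_inversions: "finite (inversions n \<tau>)"
proof -
  have "inversions n \<tau> \<subseteq> {1..n} \<times> {1..n}"
    by (auto simp: inversions_def)
  then show ?thesis
    by (rule finite_subset) auto
qed

lemma transpose_Suc_reverses:
  assumes "p < q" "transpose r (Suc r) q < transpose r (Suc r) p"
  shows "p = r \<and> q = Suc r"
  using assms by (auto simp: transpose_def split: if_splits)

text \<open>Left multiplication by a simple transposition exchanges the values \<open>r\<close> and
  \<open>Suc r\<close>, so it can only reverse the two positions holding them.\<close>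

lemma new_inversion:
  assumes "inj \<tau>" "(x, y) \<in> inversions n (transpose r (Suc r) \<circ> \<tau>)" "(x, y) \<notin> inversions n \<tau>"
  shows "\<tau> x = r \<and> \<tau> y = Suc r"
proof (rule transpose_Suc_reverses)
  have "\<tau> x \<noteq> \<tau> y"
    using assms by (auto simp: inversions_def inj_eq)
  then show "\<tau> x < \<tau> y"
    using assms by (auto simp: inversions_def)
qed (use assms in \<open>auto simp: inversions_def\<close>)

text \<open>Each letter creates at most one inversion. The start \<open>\<tau>\<close> is arbitrary
  in order to count also what the letters left of a given suffix can still contribute.\<close>

lemma card_new_inversions_le:
  assumes "inj \<tau>"
  shows "card (inversions n (word_prod u \<circ> \<tau>) - inversions n \<tau>) \<le> length u"
proof (induction u)
  case (Cons r u)
  let ?\<sigma> = "word_prod u \<circ> \<tau>"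
  let ?A = "inversions n (word_prod (r # u) \<circ> \<tau>)"
  have inj: "inj ?\<sigma>"
    using assms inj_word_prod by (rule inj_compose[rotated])
  have eq: "?A = inversions n (transpose r (Suc r) \<circ> ?\<sigma>)"
    by (simp add: comp_assoc)
  have "p = q" if "p \<in> ?A - inversions n ?\<sigma>" "q \<in> ?A - inversions n ?\<sigma>" for p q
  proof (cases p; cases q)
    fix x y x' y' assume pq: "p = (x, y)" "q = (x', y')"
    have "?\<sigma> x = r \<and> ?\<sigma> y = Suc r" "?\<sigma> x' = r \<and> ?\<sigma> y' = Suc r"
      using new_inversion[OF inj] that unfolding pq eq by blast+
    then show "p = q"
      unfolding pq using injD[OF inj, of x x'] injD[OF inj, of y y'] by simp
  qed
  then have "card (?A - inversions n ?\<sigma>) \<le> 1"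
    using finite_inversions by (auto simp: card_le_Suc0_iff_eq)
  moreover have "card (?A - inversions n \<tau>)
      \<le> card ((?A - inversions n ?\<sigma>) \<union> (inversions n ?\<sigma> - inversions n \<tau>))"
    by (intro card_mono) (auto simp: finite_inversions)
  ultimately have "card (?A - inversions n \<tau>) \<le> Suc (length u)"
    using Cons.IH card_Un_le[of "?A - inversions n ?\<sigma>" "inversions n ?\<sigma> - inversions n \<tau>"]
    by linarith
  then show ?case
    unfolding length_Cons .
qed simp

lemma card_inversions_word_prod_le: "card (inversions n (word_prod w)) \<le> length w"
proof -
  have "inversions n id = {}"
    by (auto simp: inversions_def)
  then show ?thesis
    using card_new_inversions_le[of id n w] by simp
qed

section \<open>Reduced words as content words of tableaux\<close>

text \<open>
  The cell \<open>(i, j)\<close> stands for the inversion between the entry in position \<open>s - i\<close> of the left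
  block and the one in position \<open>s + 1 + j\<close> of the right block.
\<close>

lemma word_prod_tableau:
  assumes "tableau a b xs" "a \<le> s"
  defines "\<tau> \<equiv> word_prod (map (content s) xs)"
  shows "i < a \<Longrightarrow> \<tau> (s - i) = s - i + row_len i xs"
    and "j < b \<Longrightarrow> \<tau> (s + 1 + j) = s + 1 + j - col_len j xs"
    and "x \<le> s - a \<or> s + b < x \<Longrightarrow> \<tau> x = x"
proof -
  have "(\<forall>i<a. \<tau> (s - i) = s - i + row_len i xs) \<and>
    (\<forall>j<b. \<tau> (s + 1 + j) = s + 1 + j - col_len j xs) \<and>
    (\<forall>x. x \<le> s - a \<or> s + b < x \<longrightarrow> \<tau> x = x)"
    unfolding \<tau>_def using assms(1)
  proof (induction xs)
    case (Cons p xs)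
    obtain i j where p: "p = (i, j)"
      by (cases p)
    define \<sigma> where "\<sigma> = word_prod (map (content s) xs)"
    define r where "r = s - i + j"
    have cell: "i < a" "j < b" "row_len i xs = j" "col_len j xs = i"
      using Cons.prems p by auto
    have IH: "\<And>i. i < a \<Longrightarrow> \<sigma> (s - i) = s - i + row_len i xs"
      "\<And>j. j < b \<Longrightarrow> \<sigma> (s + 1 + j) = s + 1 + j - col_len j xs"
      "\<And>x. x \<le> s - a \<or> s + b < x \<Longrightarrow> \<sigma> x = x"
      using Cons by (auto simp: \<sigma>_def)
    \<comment> \<open>The two entries of the new cell currently have the values \<open>r\<close> and
      \<open>Suc r\<close>, so the letter \<open>r\<close> exchanges exactly them; by injectivity
      all other positions keep their values.\<close>
    have \<sigma>: "\<sigma> (s - i) = r" "\<sigma> (s + 1 + j) = Suc r"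
      using IH(1)[of i] IH(2)[of j] cell assms(2) by (simp_all add: r_def)
    have inj: "inj \<sigma>"
      by (simp add: \<sigma>_def inj_word_prod)
    have other: "transpose r (Suc r) (\<sigma> x) = \<sigma> x" if "x \<noteq> s - i" "x \<noteq> s + 1 + j" for x
      using that \<sigma> injD[OF inj, of x] by (intro transpose_apply_other) metis+
    have new: "word_prod (map (content s) (p # xs)) x = transpose r (Suc r) (\<sigma> x)" for x
      by (simp add: \<sigma>_def p r_def)
    show ?case
    proof (intro conjI allI impI)
      fix i' assume "i' < a"
      then show "word_prod (map (content s) (p # xs)) (s - i') = s - i' + row_len i' (p # xs)"
        using other[of "s - i'"] IH(1)[of i'] \<sigma> cell assms(2)
        unfolding new by (cases "i' = i") (auto simp: p r_def)
    next
      fix j' assume "j' < b"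
      then show "word_prod (map (content s) (p # xs)) (s + 1 + j') =
          s + 1 + j' - col_len j' (p # xs)"
        using other[of "s + 1 + j'"] IH(2)[of j'] \<sigma> cell assms(2)
        unfolding new by (cases "j' = j") (auto simp: p r_def)
    next
      fix x assume "x \<le> s - a \<or> s + b < x"
      then show "word_prod (map (content s) (p # xs)) x = x"
        using other[of x] IH(3)[of x] cell assms(2) unfolding new by auto
    qed
  qed auto
  then show "i < a \<Longrightarrow> \<tau> (s - i) = s - i + row_len i xs"
    and "j < b \<Longrightarrow> \<tau> (s + 1 + j) = s + 1 + j - col_len j xs"
    and "x \<le> s - a \<or> s + b < x \<Longrightarrow> \<tau> x = x"
    by blast+
qed

text \<open>The given inflation with \<open>s = c + a\<close>, the last position of the left
  block.\<close>

definition block_swap :: "nat \<Rightarrow> nat \<Rightarrow> nat \<Rightarrow> nat \<Rightarrow> nat" where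
  "block_swap s a b i =
    (if i \<in> {s - a<..s} then i + b else if i \<in> {s<..s + b} then i - a else i)"

lemma tableaux_row_len:
  assumes "xs \<in> tableaux a b" "i < a"
  shows "row_len i xs = b"
proof -
  have "j < b \<longleftrightarrow> j < row_len i xs" for j
    using assms tableau_full[of a b xs] tableau_mem_row_len[of a b xs i j]
    by (auto simp: tableaux_def)
  then show ?thesis
    by (metis linorder_neqE_nat less_irrefl)
qed

lemma tableaux_col_len:
  assumes "xs \<in> tableaux a b" "j < b"
  shows "col_len j xs = a"
  using tableaux_row_len[OF tableaux_map_swap[OF assms(1)] assms(2)] by (simp add: row_len_map_swap)

lemma word_prod_tableaux:
  assumes "xs \<in> tableaux a b" "a \<le> s"
  shows "word_prod (map (content s) xs) = block_swap s a b"
proof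
  fix x
  have tab: "tableau a b xs"
    using assms by (simp add: tableaux_def)
  consider i where "i < a" "x = s - i" | j where "j < b" "x = s + 1 + j" | "x \<le> s - a \<or> s + b < x"
  proof -
    consider "s - a < x" "x \<le> s" | "s < x" "x \<le> s + b" | "x \<le> s - a \<or> s + b < x"
      by linarith
    then show ?thesis
    proof cases
      case 1 then show ?thesis by (intro that(1)[of "s - x"]) auto
    next
      case 2 then show ?thesis by (intro that(2)[of "x - (s + 1)"]) auto
    next
      case 3 then show ?thesis by (rule that(3))
    qed
  qed
  then show "word_prod (map (content s) xs) x = block_swap s a b x"
  proof cases
    case 1
    then show ?thesis
      using word_prod_tableau(1)[OF tab assms(2)] tableaux_row_len[OF assms(1)] assms(2)
      by (auto simp: block_swap_def)
  next
    case 2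
    then show ?thesis
      using word_prod_tableau(2)[OF tab assms(2)] tableaux_col_len[OF assms(1)] assms(2)
      by (auto simp: block_swap_def)
  next
    case 3
    then show ?thesis
      using word_prod_tableau(3)[OF tab assms(2)] by (auto simp: block_swap_def)
  qed
qed

lemma inversions_block_swap:
  assumes "a \<le> s" "s + b \<le> n"
  shows "inversions n (block_swap s a b) = {s - a<..s} \<times> {s<..s + b}"
  using assms by (auto simp: inversions_def block_swap_def split: if_splits)

lemma card_inversions_block_swap:
  assumes "a \<le> s" "s + b \<le> n"
  shows "card (inversions n (block_swap s a b)) = a * b"
  using assms by (simp add: inversions_block_swap card_cartesian_product)

text \<open>The word has as many letters as its product has inversions, so every letter must create
  one of the final inversions. That inversion names the cell to be added, and the letter is its
  content.\<close>

lemma suffix_is_content_word: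
  assumes "word_prod (u @ v) = block_swap s a b" "length (u @ v) = a * b" "a \<le> s"
  shows "\<exists>xs. tableau a b xs \<and> map (content s) xs = v"
  using assms(1,2)
proof (induction v arbitrary: u)
  case Nil
  show ?case
    by (intro exI[of _ "[]"]) simp
next
  case (Cons r v)
  obtain xs where tab: "tableau a b xs" and v: "map (content s) xs = v"
    using Cons.IH[of "u @ [r]"] Cons.prems by auto
  define n where "n = s + b"
  define \<tau> where "\<tau> = word_prod v"
  define \<sigma> where "\<sigma> = transpose r (Suc r) \<circ> \<tau>"
  let ?I = "inversions n (block_swap s a b)"
  have inj: "inj \<tau>" "inj \<sigma>"
    using inj_word_prod[of v] inj_word_prod[of "r # v"] by (simp_all add: \<tau>_def \<sigma>_def)
  have "word_prod u \<circ> \<sigma> = block_swap s a b"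
    using Cons.prems(1) unfolding word_prod_append word_prod_simps \<sigma>_def \<tau>_def .
  then have "card (?I - inversions n \<sigma>) \<le> length u"
    using card_new_inversions_le[OF inj(2), of n u] by metis
  moreover have "card (inversions n \<tau>) \<le> length v"
    by (simp add: \<tau>_def card_inversions_word_prod_le)
  \<comment> \<open>The letters other than \<open>r\<close> account for at most
    \<open>a * b - 1\<close> inversions, so one of the final inversions is due to
    \<open>r\<close>.\<close>
  ultimately have "card ((?I - inversions n \<sigma>) \<union> inversions n \<tau>) < card ?I"
    using card_Un_le[of "?I - inversions n \<sigma>" "inversions n \<tau>"] Cons.prems(2) assms(3)
    by (simp add: n_def card_inversions_block_swap)
  then have "\<not> ?I \<subseteq> (?I - inversions n \<sigma>) \<union> inversions n \<tau>"
    by (meson card_mono finite_Diff finite_UnI finite_inversions leD)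
  then obtain x y where xy: "(x, y) \<in> ?I" "(x, y) \<in> inversions n \<sigma>" "(x, y) \<notin> inversions n \<tau>"
    by auto
  define i j where "i = s - x" and "j = y - (s + 1)"
  have ij: "x = s - i" "i < a" "y = s + 1 + j" "j < b"
    using xy(1) assms(3) by (auto simp: i_def j_def n_def inversions_block_swap)
  have "\<tau> x = r" "\<tau> y = Suc r"
    using new_inversion[OF inj(1)] xy(2,3) unfolding \<sigma>_def by blast+
  then have *: "s - i + row_len i xs = r" "s + 1 + j - col_len j xs = Suc r"
    using word_prod_tableau[OF tab assms(3)] ij by (simp_all add: \<tau>_def v)
  \<comment> \<open>The equations in \<open>*\<close> say that row length plus column length is
    \<open>i + j\<close>. Either both lengths exceed \<open>j\<close> and \<open>i\<close> or
    neither does, so both are equalities and the cell is addable.\<close>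
  have "j < row_len i xs \<longleftrightarrow> i < col_len j xs"
    using tableau_mem_row_len[OF tab, of i j] tableau_mem_col_len[OF tab, of i j] ij by simp
  then have "row_len i xs = j" "col_len j xs = i"
    using * ij assms(3) by linarith+
  then have "tableau a b ((i, j) # xs)" "content s (i, j) = r"
    using tab ij * by simp_all
  then show ?case
    using v by (intro exI[of _ "(i, j) # xs"]) simp
qed

text \<open>The \<open>a * b\<close> inversions bound every length from below and content words of
  tableaux attain the bound. A reduced word thus has length \<open>a * b\<close>, and all of it is a
  suffix with empty prefix.\<close>

lemma reduced_words_block_swap:
  assumes "a \<le> s" "s + b \<le> n"
  shows "reduced_words n (block_swap s a b) = map (content s) ` tableaux a b"
proof -
  have content: "map (content s) xs \<in> words_for n (block_swap s a b)" if "xs \<in> tableaux a b" for xs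
  proof -
    have "set xs \<subseteq> {..<a} \<times> {..<b}"
      using that tableau_subset by (auto simp: tableaux_def)
    then have "set (map (content s) xs) \<subseteq> {1..n - 1}"
      using assms by fastforce
    then show ?thesis
      using word_prod_tableaux[OF that assms(1)] by (simp add: words_for_def)
  qed
  have min: "a * b \<le> length w" if "w \<in> words_for n (block_swap s a b)" for w
    using that card_inversions_word_prod_le[of n w] card_inversions_block_swap[OF assms]
    by (simp add: words_for_def)
  show ?thesis
  proof (intro equalityI subsetI)
    fix w assume w: "w \<in> reduced_words n (block_swap s a b)"
    have "length w \<le> a * b"
      using w content[OF stacked_rows_in_tableaux]
      by (auto simp: reduced_words_def length_stacked_rows)
    then have "length w = a * b"
      using w min by (auto simp: reduced_words_def intro: antisym)
    moreover have "word_prod w = block_swap s a b"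
      using w by (simp add: reduced_words_def words_for_def)
    ultimately obtain xs where xs: "tableau a b xs" "map (content s) xs = w"
      using suffix_is_content_word[of "[]" w s a b] assms(1) by auto
    then have "xs \<in> tableaux a b"
      using \<open>length w = a * b\<close> by (auto simp: tableaux_def)
    then show "w \<in> map (content s) ` tableaux a b"
      using xs(2) by blast
  next
    fix w assume "w \<in> map (content s) ` tableaux a b"
    then show "w \<in> reduced_words n (block_swap s a b)"
      using content min by (auto simp: reduced_words_def tableaux_def)
  qed
qed

section \<open>Counting pairs of disjoint inversions\<close>

lemma card_L2_block_swap:
  assumes "a \<le> s" "s + b \<le> n"
  shows "card_L2 n (block_swap s a b) = 2 * card (incomparable a b)"
proof -
  let ?\<pi> = "block_swap s a b"
  define l where "l = (\<lambda>i. s - i)"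
  \<comment> \<open>\<open>?F\<close> matches the two rows with the two columns as in the
    incomparable pair itself, \<open>?G\<close> takes the opposite corners of the same
    rectangle.\<close>
  let ?F = "\<lambda>((i, j), (i', j')). {(l i, s + 1 + j), (l i', s + 1 + j')}"
  let ?G = "\<lambda>((i, j), (i', j')). {(l i, s + 1 + j'), (l i', s + 1 + j)}"
  have l_eq: "l i = l i' \<longleftrightarrow> i = i'" if "i < a" "i' < a" for i i'
    using that assms(1) by (auto simp: l_def)
  have inv: "inversions n ?\<pi> = {s - a<..s} \<times> {s<..s + b}"
    by (rule inversions_block_swap[OF assms])
  \<comment> \<open>The middle entry of a \<open>321\<close> would belong to both blocks.\<close>
  have I3: "I3 n ?\<pi> = {}"
    by (auto simp: I3_def inv)
  have F: "inj_on ?F (incomparable a b)" and G: "inj_on ?G (incomparable a b)"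
    by (auto simp: inj_on_def incomparable_def doubleton_eq_iff l_eq)
  have disjoint: "?F ` incomparable a b \<inter> ?G ` incomparable a b = {}"
  proof (rule equals0I)
    fix e assume "e \<in> ?F ` incomparable a b \<inter> ?G ` incomparable a b"
    then obtain i j i' j' k m k' m' where less: "i < i'" "i' < a" "j' < j" "k < k'" "k' < a" "m' < m"
      and "{(l i, s + 1 + j), (l i', s + 1 + j')} = {(l k, s + 1 + m'), (l k', s + 1 + m)}"
      unfolding incomparable_def by force
    \<comment> \<open>Matching the elements directly contradicts the order of the columns, matching
      them crosswise that of the rows.\<close>
    then consider "l i = l k" "j = m'" "j' = m" | "l i = l k'" "l i' = l k"
      by (auto simp: doubleton_eq_iff)
    then show False
      by cases (use less l_eq[of i k'] l_eq[of i' k] in auto)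
  qed
  have I2: "I2 n ?\<pi> = ?F ` incomparable a b \<union> ?G ` incomparable a b"
  proof (intro equalityI subsetI)
    fix e assume "e \<in> I2 n ?\<pi>"
    then obtain x y x' y' where e: "e = {(x, y), (x', y')}"
      and xy: "x \<in> {s - a<..s}" "y \<in> {s<..s + b}" "x' \<in> {s - a<..s}" "y' \<in> {s<..s + b}"
      and ne: "x \<noteq> x'" "y \<noteq> y'"
      unfolding I2_def inv by auto
    define i j i' j' where "i = s - x" "j = y - (s + 1)" "i' = s - x'" "j' = y' - (s + 1)"
    then have ij: "x = l i" "y = s + 1 + j" "x' = l i'" "y' = s + 1 + j'"
      "i < a" "i' < a" "j < b" "j' < b"
      using xy assms(1) by (auto simp: l_def)
    have "i \<noteq> i'" "j \<noteq> j'"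
      using ne ij by auto
    then consider "i < i'" "j' < j" | "i < i'" "j < j'" | "i' < i" "j < j'" | "i' < i" "j' < j"
      by linarith
    then show "e \<in> ?F ` incomparable a b \<union> ?G ` incomparable a b"
    proof cases
      case 1
      then have "e = ?F ((i, j), (i', j'))" "((i, j), (i', j')) \<in> incomparable a b"
        using e ij by (simp_all add: incomparable_def)
      then show ?thesis by blast
    next
      case 2
      then have "e = ?G ((i, j'), (i', j))" "((i, j'), (i', j)) \<in> incomparable a b"
        using e ij by (simp_all add: incomparable_def)
      then show ?thesis by blast
    next
      case 3
      then have "e = ?F ((i', j'), (i, j))" "((i', j'), (i, j)) \<in> incomparable a b"
        using e ij by (simp_all add: incomparable_def insert_commute)
      then show ?thesis by blast
    next
      case 4
      then have "e = ?G ((i', j), (i, j'))" "((i', j), (i, j')) \<in> incomparable a b"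
        using e ij by (simp_all add: incomparable_def insert_commute)
      then show ?thesis by blast
    qed
  next
    fix e assume "e \<in> ?F ` incomparable a b \<union> ?G ` incomparable a b"
    then obtain i j i' j' where ij: "i < i'" "i' < a" "j' < j" "j < b"
      and e: "e = {(l i, s + 1 + j), (l i', s + 1 + j')} \<or> e = {(l i, s + 1 + j'), (l i', s + 1 + j)}"
      by (auto simp: incomparable_def)
    have "{(l i, s + 1 + k), (l i', s + 1 + k')} \<in> I2 n ?\<pi>" if "k \<noteq> k'" "k < b" "k' < b" for k k'
    proof -
      have "(l i, s + 1 + k) \<in> inversions n ?\<pi> \<and> (l i', s + 1 + k') \<in> inversions n ?\<pi>
        \<and> {l i, s + 1 + k} \<inter> {l i', s + 1 + k'} = {}"
        using ij that assms(1) by (auto simp: inv l_def)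
      then show ?thesis
        unfolding I2_def by blast
    qed
    then show "e \<in> I2 n ?\<pi>"
      using e ij by auto
  qed
  show ?thesis
    unfolding card_L2_def I3 I2
    using card_Un_disjoint[OF _ _ disjoint] card_image[OF F] card_image[OF G]
    by (simp add: finite_incomparable)
qed

section \<open>Distances between reduced words\<close>

text \<open>Bubble sort: exchanging two neighbours that \<open>ys\<close> orders the other way is a
  commutation move and removes exactly one reversed pair.\<close>

lemma word_graph_walk_upper:
  fixes n a b s :: nat and \<pi> :: "nat \<Rightarrow> nat"
  defines "G \<equiv> with_proj (word_graph n \<pi>)"
  assumes words: "reduced_words n \<pi> = map (content s) ` tableaux a b" and "a \<le> s"
    and "xs \<in> tableaux a b" and ys: "ys \<in> tableaux a b"
  shows "\<exists>p. pre_digraph.awalk G (map (content s) xs) p (map (content s) ys)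
    \<and> length p = card (order_pairs xs - order_pairs ys)"
  using \<open>xs \<in> tableaux a b\<close>
proof (induction "card (order_pairs xs - order_pairs ys)" arbitrary: xs)
  interpret pair_graph "word_graph n \<pi>"
    by (rule pair_graph_word_graph)
  have verts: "map (content s) zs \<in> verts G" if "zs \<in> tableaux a b" for zs
    using that by (simp add: G_def word_graph_def words)
  have tab_ys: "tableau a b ys" "set ys = {..<a} \<times> {..<b}" "distinct ys"
    using ys tableau_full tableau_distinct by (auto simp: tableaux_def)
  {
    case 0
    then have "tableau a b xs" "set xs = {..<a} \<times> {..<b}" "distinct xs"
      using tableau_full tableau_distinct by (auto simp: tableaux_def)
    moreover have "order_pairs xs \<subseteq> order_pairs ys"
      using 0(1) by (simp add: finite_order_pairs)
    ultimately have "xs = ys"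
      using tab_ys by (intro order_pairs_subset_imp_eq) auto
    then show ?case
      using verts[OF ys] by (auto simp: G_def awalk_Nil_iff intro!: exI[of _ "[]"])
  next
    case (Suc k)
    have tab_xs: "tableau a b xs" "set xs = {..<a} \<times> {..<b}" "distinct xs"
      using Suc.prems tableau_full tableau_distinct by (auto simp: tableaux_def)
    have "\<not> order_pairs xs \<subseteq> order_pairs ys"
      using Suc.hyps(2) by (metis Diff_eq_empty_iff card.empty nat.distinct(1))
    moreover have "trans (order_pairs ys)"
      using order_pairs_trans[OF tab_ys(3)] by (rule transI)
    ultimately obtain us p q vs where xs: "xs = us @ [p, q] @ vs" and pq: "(p, q) \<notin> order_pairs ys"
      using ex_adjacent_not_related by blast
    define zs where "zs = us @ [q, p] @ vs"
    have "p \<noteq> q" "p \<in> set ys" "q \<in> set ys"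
      using tab_xs(2,3) unfolding tab_ys(2) by (auto simp: xs)
    then have qp: "(q, p) \<in> order_pairs ys"
      using pq order_pairs_total[of p ys q] by blast
    have "(p, q) \<in> order_pairs xs"
      by (simp add: xs order_pairs_append)
    then have inc: "fst q < fst p \<or> snd q < snd p" "fst p < fst q \<or> snd p < snd q"
      using tableau_order_pairs[OF tab_xs(1), of "fst p" "snd p" "fst q" "snd q"]
        tableau_order_pairs[OF tab_ys(1), of "fst q" "snd q" "fst p" "snd p"] qp by simp_all
    have "p \<in> {..<a} \<times> {..<b}" "q \<in> {..<a} \<times> {..<b}"
      unfolding tab_xs(2)[symmetric] by (simp_all add: xs)
    then have "fst p < a" "fst q < a"
      by (simp_all add: mem_Times_iff)
    \<comment> \<open>One coordinate grows and the other shrinks from \<open>p\<close> to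
      \<open>q\<close>, so the contents differ by at least two.\<close>
    then have far: "\<bar>int (content s p) - int (content s q)\<bar> > 1"
      using inc \<open>a \<le> s\<close> by (cases p; cases q) auto
    have "tableau a b zs"
      using tableau_swap[of a b us p q vs s] tab_xs(1) far \<open>a \<le> s\<close> unfolding xs zs_def by blast
    moreover have "length zs = length xs"
      by (simp add: xs zs_def)
    ultimately have zs: "zs \<in> tableaux a b"
      using Suc.prems by (simp add: tableaux_def)
    have "map (content s) xs = map (content s) us @ [content s p, content s q] @ map (content s) vs"
      "map (content s) zs = map (content s) us @ [content s q, content s p] @ map (content s) vs"
      by (simp_all add: xs zs_def)
    then have "commutation_move (map (content s) xs) (map (content s) zs)"
      unfolding commutation_move_def using far by blast
    then have arc: "(map (content s) xs, map (content s) zs) \<in> arcs G"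
      using Suc.prems zs by (auto simp: G_def word_graph_def words)
    have "order_pairs zs = insert (q, p) (order_pairs xs - {(p, q)})"
      using order_pairs_swap[of us p q vs] tab_xs(3) unfolding xs zs_def by blast
    then have "order_pairs zs - order_pairs ys = order_pairs xs - order_pairs ys - {(p, q)}"
      using qp by auto
    then have k: "k = card (order_pairs zs - order_pairs ys)"
      using Suc.hyps(2) \<open>(p, q) \<in> order_pairs xs\<close> pq by (simp add: finite_order_pairs)
    obtain w where "awalk (map (content s) zs) w (map (content s) ys)" "length w = k"
      using Suc.hyps(1)[OF k zs] k by (auto simp: G_def)
    then have "awalk (map (content s) xs) ((map (content s) xs, map (content s) zs) # w)
        (map (content s) ys)"
      using arc by (simp add: G_def awalk_Cons_iff)
    then show ?case
      using \<open>length w = k\<close> Suc.hyps(2) unfolding G_def by (metis length_Cons)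
  }
qed

lemma map_eq_append_two:
  assumes "map f xs = us @ [j, k] @ vs"
  obtains us' p q vs' where "xs = us' @ [p, q] @ vs'" "map f us' = us" "f p = j" "f q = k"
    "map f vs' = vs"
  using assms by (auto simp: map_eq_append_conv append_eq_map_conv map_eq_Cons_conv Cons_eq_map_conv)

text \<open>The number of pairs of a fixed set \<open>P\<close> in the order of the current tableau
  serves as a potential: every arc is an exchange of two adjacent cells and raises it by at most
  one.\<close>

lemma word_graph_walk_lower:
  fixes n a b s :: nat and \<pi> :: "nat \<Rightarrow> nat"
  defines "G \<equiv> with_proj (word_graph n \<pi>)"
  assumes words: "reduced_words n \<pi> = map (content s) ` tableaux a b" and "a \<le> s"
    and walk: "pre_digraph.awalk G (map (content s) xs) w (map (content s) ys)"
    and "xs \<in> tableaux a b" and ys: "ys \<in> tableaux a b"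
  shows "card (P \<inter> order_pairs ys) \<le> card (P \<inter> order_pairs xs) + length w"
  using walk \<open>xs \<in> tableaux a b\<close>
proof (induction w arbitrary: xs)
  interpret pair_graph "word_graph n \<pi>"
    by (rule pair_graph_word_graph)
  {
    case Nil
    then have "xs = ys"
      using tableau_map_content_inj[of a b xs ys s] ys \<open>a \<le> s\<close>
      by (auto simp: G_def awalk_Nil_iff tableaux_def)
    then show ?case
      by simp
  next
    case (Cons e w)
    obtain v where e: "e = (map (content s) xs, v)" "e \<in> arcs G"
      and w: "awalk v w (map (content s) ys)"
      using Cons.prems(1) by (cases e) (auto simp: G_def awalk_Cons_iff)
    obtain zs where zs: "zs \<in> tableaux a b" "v = map (content s) zs"
      using e by (auto simp: G_def word_graph_def words)
    have tab: "tableau a b xs" "tableau a b zs"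
      using Cons.prems(2) zs(1) by (auto simp: tableaux_def)
    have "\<not> braid_move (map (content s) xs) v"
    proof
      assume "braid_move (map (content s) xs) v"
      then obtain us vs j k where "map (content s) xs = us @ [j, k, j] @ vs"
        unfolding braid_move_def by blast
      then obtain us' p q r vs' where "xs = us' @ [p, q, r] @ vs'" "content s p = content s r"
        by (auto simp: map_eq_append_conv map_eq_Cons_conv)
      then show False
        using tableau_no_braid tab(1) \<open>a \<le> s\<close> by blast
    qed
    then have "commutation_move (map (content s) xs) v"
      using e by (auto simp: G_def word_graph_def)
    then obtain us j k vs where far: "\<bar>int j - int k\<bar> > 1"
      and u: "map (content s) xs = us @ [j, k] @ vs" and v: "v = us @ [k, j] @ vs"
      unfolding commutation_move_def by blast
    obtain us' p q vs' where xs: "xs = us' @ [p, q] @ vs'"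
      and maps: "map (content s) us' = us" "content s p = j" "content s q = k" "map (content s) vs' = vs"
      using u by (rule map_eq_append_two)
    have "tableau a b (us' @ [q, p] @ vs')"
      using tableau_swap[of a b us' p q vs' s] tab(1) far maps \<open>a \<le> s\<close> unfolding xs by blast
    moreover have "map (content s) (us' @ [q, p] @ vs') = map (content s) zs"
      using v maps zs(2) by simp
    \<comment> \<open>\<open>zs\<close> was only some tableau with word \<open>v\<close>;
      injectivity of content words identifies it with the exchanged list.\<close>
    ultimately have "zs = us' @ [q, p] @ vs'"
      using tableau_map_content_inj tab(2) \<open>a \<le> s\<close> by metis
    then have "order_pairs zs \<subseteq> insert (q, p) (order_pairs xs)"
      using order_pairs_swap[of us' p q vs'] tableau_distinct[OF tab(1)] unfolding xs by blast
    then have "card (P \<inter> order_pairs zs) \<le> card (insert (q, p) (P \<inter> order_pairs xs))"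
      by (intro card_mono) (auto simp: finite_order_pairs)
    also have "\<dots> \<le> Suc (card (P \<inter> order_pairs xs))"
      by (rule card_insert_le_m1) simp_all
    finally have "card (P \<inter> order_pairs zs) \<le> Suc (card (P \<inter> order_pairs xs))" .
    moreover have "card (P \<inter> order_pairs ys) \<le> card (P \<inter> order_pairs zs) + length w"
      using Cons.IH[of zs] w zs by (simp add: G_def)
    ultimately show ?case
      by simp
  }
qed

lemma diam_word_graph:
  assumes words: "reduced_words n \<pi> = map (content s) ` tableaux a b" and "a \<le> s"
  shows "diam (word_graph n \<pi>) = ereal (card (incomparable a b))"
proof (rule antisym)
  have verts: "pverts (word_graph n \<pi>) = map (content s) ` tableaux a b"
    by (simp add: word_graph_def words)
  show "diam (word_graph n \<pi>) \<le> ereal (card (incomparable a b))"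
    unfolding diam_def verts
  proof (intro SUP_least, clarify)
    fix xs ys assume xs: "xs \<in> tableaux a b" and ys: "ys \<in> tableaux a b"
    obtain w where w: "pre_digraph.awalk (with_proj (word_graph n \<pi>))
        (map (content s) xs) w (map (content s) ys)"
      "length w = card (order_pairs xs - order_pairs ys)"
      using word_graph_walk_upper[OF words assms(2) xs ys] by blast
    have "ereal (length w) \<le> ereal (card (incomparable a b))"
      using w(2) card_reversed_pairs_le[OF xs ys] by simp
    then show "graph_dist (word_graph n \<pi>) (map (content s) xs) (map (content s) ys)
        \<le> ereal (card (incomparable a b))"
      unfolding graph_dist_word_graph using w(1) by (intro INF_lower2[of w]) auto
  qed
  \<comment> \<open>The order of \<open>?xs\<close> contains no pair of
    \<open>incomparable a b\<close> and that of \<open>?ys\<close> contains all, so the potential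
    must rise by its full cardinality.\<close>
  let ?xs = "stacked_rows b a" and ?ys = "map prod.swap (stacked_rows a b)"
  have xs: "?xs \<in> tableaux a b" and ys: "?ys \<in> tableaux a b"
    using stacked_rows_in_tableaux tableaux_map_swap by blast+
  have "ereal (card (incomparable a b))
      \<le> graph_dist (word_graph n \<pi>) (map (content s) ?xs) (map (content s) ?ys)"
    unfolding graph_dist_word_graph
  proof (rule INF_greatest, clarify)
    fix w assume "pre_digraph.awalk (with_proj (word_graph n \<pi>))
      (map (content s) ?xs) w (map (content s) ?ys)"
    from word_graph_walk_lower[OF words assms(2) this xs ys, of "incomparable a b"]
    show "ereal (card (incomparable a b)) \<le> ereal (length w)"
      using incomparable_stacked_rows[of a b] incomparable_stacked_columns[of a b]
      by (simp add: Int_absorb2)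
  qed
  also have "\<dots> \<le> diam (word_graph n \<pi>)"
    unfolding diam_def verts 
    by (rule SUP_upper2[OF imageI[OF xs]]) (rule SUP_upper[OF imageI[OF ys]])
  finally show "ereal (card (incomparable a b)) \<le> diam (word_graph n \<pi>)" .
qed

theorem theorem6p10:
  fixes a b c d :: nat and \<pi> :: "nat \<Rightarrow> nat"
  assumes "a \<ge> 2" and "b \<ge> 2"
    and "\<pi> = perm_of_word (inflate123 (iota c) (inflate21 (iota a) (iota b)) (iota d))"
  shows "diam (word_graph (a + b + c + d) \<pi>) = ereal (1 / 2 * real (card_L2 (a + b + c + d) \<pi>))"
proof -
  have \<pi>: "\<pi> = block_swap (c + a) a b"
    by (rule ext) (auto simp: assms(3) perm_of_word_inflation block_swap_def)
  have bounds: "a \<le> c + a" "c + a + b \<le> a + b + c + d"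
    by simp_all
  show ?thesis
    unfolding \<pi> diam_word_graph[OF reduced_words_block_swap[OF bounds] bounds(1)]
      card_L2_block_swap[OF bounds]
    by simp
qed

end
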